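(* Let $n\in\mathbb{N}$ be the number of qubits, let $L\in\mathbb{N}$ be the number of variational layers, and let $\theta=\{\boldsymbol{a},\boldsymbol{b},\Gamma,\boldsymbol{c},c_0\}$ denote the full set of parameters of the quantum neural network (QNN) defined in the context. Then, for any input $\boldsymbol{x}\in\mathbb{R}^d$, the QNN output takes the form $$u_\theta(\boldsymbol{x})=\sum_{i=1}^n c_i\,F_i\big(\boldsymbol{a}_1^{T}\boldsymbol{x}+b_1,\dots,\boldsymbol{a}_n^{T}\boldsymbol{x}+b_n;\Gamma\big)+c_0,$$ where each $F_i(\cdot\,;\Gamma)$ is a real trigonometric polynomial in $n$ real variables which depends only on the variational parameters $\Gamma$ and not on the input $\boldsymbol{x}$.
   Context: QNN architecture. Fix $d,n,L\in\mathbb{N}$. The state space is $(\mathbb{C}^2)^{\otimes n}$ with standard basis state $|0\rangle^{\otimes n}$. The parameters are $\boldsymbol{a}=(\boldsymbol{a}_1,\dots,\boldsymbol{a}_n)\in(\mathbb{R}^d)^n$, $\boldsymbol{b}=(b_1,\dots,b_n)\in\mathbb{R}^n$, $\Gamma=\{(\alpha_{\ell i},\beta_{\ell i},\gamma_{\ell i})\in\mathbb{R}^3:1\le \ell\le L,\ 1\le i\le n\}$, $\boldsymbol{c}=(c_1,\dots,c_n)\in\mathbb{R}^n$, $c_0\in\mathbb{R}$. Single-qubit gates: $$R_y(z)=\begin{pmatrix}\cos(z/2)&-\sin(z/2)\\ \sin(z/2)&\cos(z/2)\end{pmatrix},\qquad R_z(\alpha)=\begin{pmatrix}e^{-i\alpha/2}&0\\0&e^{i\alpha/2}\end{pmatrix}.$$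 Feature map: for $\boldsymbol{x}\in\mathbb{R}^d$ put $z_i=\boldsymbol{a}_i^T\boldsymbol{x}+b_i$ and $U_{\psi(\boldsymbol{x})}=\bigotimes_{i=1}^n R_y(z_i)$. Entangler: $E=\big(\prod_{k=1}^{n-1}\mathrm{CNOT}_{k,k+1}\big)\mathrm{CNOT}_{n,1}$, where $\mathrm{CNOT}_{j,k}$ has control qubit $j$ and target qubit $k$; for $n=1$, $E$ is the identity. Variational layers: $U(\Gamma^\ell)=E\big(\bigotimes_{i=1}^n R_z(\gamma_{\ell i})R_y(\beta_{\ell i})R_z(\alpha_{\ell i})\big)$ and $U_\Theta(\Gamma)=\prod_{\ell=1}^L U(\Gamma^\ell)$. Measurement: with $Z=\mathrm{diag}(1,-1)$ and $Z_i=I^{\otimes(i-1)}\otimes Z\otimes I^{\otimes(n-i)}$, the $i$-th quantum expectation is $$\phi_i(\boldsymbol{x})=\langle 0|^{\otimes n}\big(U_\Theta(\Gamma)U_{\psi(\boldsymbol{x})}\big)^\dagger Z_i\,\big(U_\Theta(\Gamma)U_{\psi(\boldsymbol{x})}\big)|0\rangle^{\otimes n}.$$ Output: $u_\theta(\boldsymbol{x})=\sum_{i=1}^n c_i\phi_i(\boldsymbol{x})+c_0$. A real trigonometric polynomial in $z_1,\dots,z_n$ means a real polynomial in the functions $\cos z_1,\sin z_1,\dots,\cos z_n,\sin z_n$. *)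

theory Defs
  imports "Jordan_Normal_Form.Schur_Decomposition"
begin

text \<open>Kronecker product; the left factor carries the most significant part of the index, so that
  qubit 1 is the leftmost tensor factor.\<close>

definition kron :: "complex mat \<Rightarrow> complex mat \<Rightarrow> complex mat" where
  "kron A B = mat (dim_row A * dim_row B) (dim_col A * dim_col B)
     (\<lambda>(i, j). A $$ (i div dim_row B, j div dim_col B) * B $$ (i mod dim_row B, j mod dim_col B))"

text \<open>\<open>tensor n A\<close> is $A_1 \otimes \dots \otimes A_n$.\<close>

definition tensor :: "nat \<Rightarrow> (nat \<Rightarrow> complex mat) \<Rightarrow> complex mat" where
  "tensor n A = foldr kron (map A [1..<Suc n]) (1\<^sub>m 1)"

text \<open>\<open>mat_prod N m A\<close> is the ordered product $A_1 A_2 \cdots A_m$ of $N \times N$ matrices: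
  the factor with index 1 is leftmost, i.e. is applied last to a state.\<close>

definition mat_prod :: "nat \<Rightarrow> nat \<Rightarrow> (nat \<Rightarrow> complex mat) \<Rightarrow> complex mat" where
  "mat_prod N m A = foldr (*) (map A [1..<Suc m]) (1\<^sub>m N)"

definition Ry :: "real \<Rightarrow> complex mat" where
  "Ry z = mat_of_rows_list 2
     [[of_real (cos (z / 2)), - of_real (sin (z / 2))],
      [of_real (sin (z / 2)), of_real (cos (z / 2))]]"

definition Rz :: "real \<Rightarrow> complex mat" where
  "Rz \<alpha> = mat_of_rows_list 2
     [[exp (- \<i> * of_real \<alpha> / 2), 0],
      [0, exp (\<i> * of_real \<alpha> / 2)]]"

definition pauli_X :: "complex mat" where
  "pauli_X = mat_of_rows_list 2 [[0, 1], [1, 0]]"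

definition pauli_Z :: "complex mat" where
  "pauli_Z = mat_of_rows_list 2 [[1, 0], [0, -1]]"

definition proj0 :: "complex mat" where
  "proj0 = mat_of_rows_list 2 [[1, 0], [0, 0]]"

definition proj1 :: "complex mat" where
  "proj1 = mat_of_rows_list 2 [[0, 0], [0, 1]]"

text \<open>$\mathrm{CNOT}_{j,k} = |0\rangle\langle 0|_j \otimes I + |1\rangle\langle 1|_j \otimes X_k$
  on \<open>n\<close> qubits, for distinct \<open>j\<close> (control) and \<open>k\<close> (target) in \<open>{1..n}\<close>.\<close>

definition CNOT :: "nat \<Rightarrow> nat \<Rightarrow> nat \<Rightarrow> complex mat" where
  "CNOT n j k =
     tensor n (\<lambda>i. if i = j then proj0 else 1\<^sub>m 2) +
     tensor n (\<lambda>i. if i = j then proj1 else if i = k then pauli_X else 1\<^sub>m 2)"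

definition entangler :: "nat \<Rightarrow> complex mat" where
  "entangler n =
     (if n \<le> 1 then 1\<^sub>m (2 ^ n)
      else mat_prod (2 ^ n) (n - 1) (\<lambda>k. CNOT n k (k + 1)) * CNOT n n 1)"

text \<open>\<open>\<Gamma> l i\<close> is the triple $(\alpha_{\ell i}, \beta_{\ell i}, \gamma_{\ell i})$. Only the indices
  \<open>1 \<le> l \<le> L\<close> and \<open>1 \<le> i \<le> n\<close> are used, and likewise for the other parameters.\<close>

type_synonym var_params = "nat \<Rightarrow> nat \<Rightarrow> real \<times> real \<times> real"

definition rotation_gate :: "real \<times> real \<times> real \<Rightarrow> complex mat" where
  "rotation_gate = (\<lambda>(\<alpha>, \<beta>, \<gamma>). Rz \<gamma> * Ry \<beta> * Rz \<alpha>)"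

definition var_layer :: "nat \<Rightarrow> (nat \<Rightarrow> real \<times> real \<times> real) \<Rightarrow> complex mat" where
  "var_layer n g = entangler n * tensor n (\<lambda>i. rotation_gate (g i))"

definition U_Theta :: "nat \<Rightarrow> nat \<Rightarrow> var_params \<Rightarrow> complex mat" where
  "U_Theta n L \<Gamma> = mat_prod (2 ^ n) L (\<lambda>l. var_layer n (\<Gamma> l))"

definition feature_arg :: "(nat \<Rightarrow> real vec) \<Rightarrow> (nat \<Rightarrow> real) \<Rightarrow> real vec \<Rightarrow> nat \<Rightarrow> real" where
  "feature_arg a b x i = scalar_prod (a i) x + b i"

definition U_psi :: "nat \<Rightarrow> (nat \<Rightarrow> real vec) \<Rightarrow> (nat \<Rightarrow> real) \<Rightarrow> real vec \<Rightarrow> complex mat" where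
  "U_psi n a b x = tensor n (\<lambda>i. Ry (feature_arg a b x i))"

definition ket0 :: "nat \<Rightarrow> complex mat" where
  "ket0 n = tensor n (\<lambda>_. mat_of_rows_list 1 [[1], [0]])"

definition Z_at :: "nat \<Rightarrow> nat \<Rightarrow> complex mat" where
  "Z_at n i = tensor n (\<lambda>j. if j = i then pauli_Z else 1\<^sub>m 2)"

text \<open>The expectation is the single entry of a \<open>1 \<times> 1\<close> matrix. It is kept as a complex number, so
  that its being real is not built into the definition.\<close>

definition q_expect ::
  "nat \<Rightarrow> nat \<Rightarrow> (nat \<Rightarrow> real vec) \<Rightarrow> (nat \<Rightarrow> real) \<Rightarrow> var_params \<Rightarrow> nat \<Rightarrow> real vec \<Rightarrow> complex" where
  "q_expect n L a b \<Gamma> i x =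
     (let W = U_Theta n L \<Gamma> * U_psi n a b x
      in (mat_adjoint (ket0 n) * (mat_adjoint W * Z_at n i * W) * ket0 n) $$ (0, 0))"

definition qnn_output ::
  "nat \<Rightarrow> nat \<Rightarrow> (nat \<Rightarrow> real vec) \<Rightarrow> (nat \<Rightarrow> real) \<Rightarrow> var_params \<Rightarrow> (nat \<Rightarrow> real) \<Rightarrow> real \<Rightarrow>
   real vec \<Rightarrow> complex" where
  "qnn_output n L a b \<Gamma> c c0 x =
     (\<Sum>i = 1..n. of_real (c i) * q_expect n L a b \<Gamma> i x) + of_real c0"

text \<open>A real polynomial in $\cos z_1, \sin z_1, \dots, \cos z_n, \sin z_n$: a finite sum of
  \<open>m\<close> monomials with coefficients \<open>q k\<close> and exponents \<open>e k j\<close> of $\cos z_j$ and \<open>f k j\<close> of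
  $\sin z_j$.\<close>

definition real_trig_poly :: "nat \<Rightarrow> ((nat \<Rightarrow> real) \<Rightarrow> real) \<Rightarrow> bool" where
  "real_trig_poly n F \<longleftrightarrow>
     (\<exists>(m :: nat) (q :: nat \<Rightarrow> real) (e :: nat \<Rightarrow> nat \<Rightarrow> nat) (f :: nat \<Rightarrow> nat \<Rightarrow> nat).
        \<forall>z. F z = (\<Sum>k<m. q k * (\<Prod>j = 1..n. cos (z j) ^ e k j * sin (z j) ^ f k j)))"

end

theory Submission
  imports Defs
begin

text \<open>
  In the Heisenberg picture the trainable part of the circuit conjugates the observable: with
  \<open>M = U\<^sup>* Z\<^sub>i U\<close>, where \<open>U\<close> is the product of the variational layers, the \<open>i\<close>-th expectation is
  \<open>\<langle>0| \<Psi>(z)\<^sup>* M \<Psi>(z) |0\<rangle>\<close> with \<open>\<Psi>(z)\<close> the tensor product of the rotations \<open>Ry z\<^sub>j\<close>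
  (\<open>q_expect_eq_circuit_expect\<close>). The matrix \<open>M\<close> depends on \<open>\<Gamma>\<close> only and the input enters through
  \<open>z\<close> only, so the real part of this expression is the function \<open>F\<^sub>i\<close>. Two things remain.

  Expanding the matrix products writes the expectation as a sum of constants times products of two
  entries of \<open>\<Psi>(z)\<close>, one of them conjugated. Entries of a tensor product are products of one entry
  per factor (\<open>tensor_entry\<close>), hence each term is a product over the qubits of two entries of
  \<open>Ry z\<^sub>j\<close>. A single entry involves the half angle \<open>z\<^sub>j / 2\<close> and is not a trigonometric polynomial in
  \<open>z\<^sub>j\<close>, but a product of two is one by the double angle formulas (\<open>Ry_entry_product_trig_poly\<close>).
  Since trigonometric polynomials form an algebra, the expectation is one with complex
  coefficients (\<open>circuit_expect_trig_poly\<close>).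

  The matrix \<open>M\<close> is Hermitian because \<open>Z\<^sub>i\<close> is, and so is every \<open>A\<^sup>* M A\<close>
  (\<open>mat_adjoint_sandwich\<close>). Hence the expectation is real (\<open>circuit_expect_real\<close>) and equals its
  real part.
\<close>

section \<open>The algebra of real trigonometric polynomials\<close>

text \<open>Arbitrary finite index sets let sums be indexed by disjoint unions and products by Cartesian
  products, instead of encoding these into initial segments of the naturals.\<close>

lemma real_trig_poly_finite_sum:
  assumes "finite I"
    and "\<And>z. F z = (\<Sum>k\<in>I. q k * (\<Prod>j = 1..n. cos (z j) ^ e k j * sin (z j) ^ f k j))"
  shows "real_trig_poly n F"
proof -
  obtain h where h: "bij_betw h {0..<card I} I"
    using ex_bij_betw_nat_finite[OF assms(1)] by blast
  have "F z = (\<Sum>k<card I. q (h k) * (\<Prod>j = 1..n. cos (z j) ^ e (h k) j * sin (z j) ^ f (h k) j))" for z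
    unfolding assms(2) using sum.reindex_bij_betw[OF h, symmetric] by (simp add: lessThan_atLeast0)
  then show ?thesis
    unfolding real_trig_poly_def by (intro exI allI)
qed

lemma real_trig_poly_const: "real_trig_poly n (\<lambda>z. r)"
  by (rule real_trig_poly_finite_sum[where I = "{()}" and q = "\<lambda>_. r" and e = "\<lambda>_ _. 0" and f = "\<lambda>_ _. 0"]) auto

lemma real_trig_poly_cos:
  assumes "j \<in> {1..n}" shows "real_trig_poly n (\<lambda>z. cos (z j))"
proof (rule real_trig_poly_finite_sum[where I = "{()}" and q = "\<lambda>_. 1"
      and e = "\<lambda>_ i. if i = j then 1 else 0" and f = "\<lambda>_ _. 0"])
  fix z :: "nat \<Rightarrow> real"
  have "(\<Prod>i = 1..n. cos (z i) ^ (if i = j then 1 else 0)) = (\<Prod>i = 1..n. if i = j then cos (z i) else 1)"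
    by (intro prod.cong) auto
  also have "\<dots> = cos (z j)"
    using assms by (simp add: prod.delta)
  finally show "cos (z j) = (\<Sum>k\<in>{()}. 1 * (\<Prod>i = 1..n. cos (z i) ^ (if i = j then 1 else 0) * sin (z i) ^ 0))"
    by simp
qed simp

lemma real_trig_poly_sin:
  assumes "j \<in> {1..n}" shows "real_trig_poly n (\<lambda>z. sin (z j))"
proof (rule real_trig_poly_finite_sum[where I = "{()}" and q = "\<lambda>_. 1"
      and e = "\<lambda>_ _. 0" and f = "\<lambda>_ i. if i = j then 1 else 0"])
  fix z :: "nat \<Rightarrow> real"
  have "(\<Prod>i = 1..n. sin (z i) ^ (if i = j then 1 else 0)) = (\<Prod>i = 1..n. if i = j then sin (z i) else 1)"
    by (intro prod.cong) auto
  also have "\<dots> = sin (z j)"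
    using assms by (simp add: prod.delta)
  finally show "sin (z j) = (\<Sum>k\<in>{()}. 1 * (\<Prod>i = 1..n. cos (z i) ^ 0 * sin (z i) ^ (if i = j then 1 else 0)))"
    by simp
qed simp

lemma real_trig_poly_add:
  assumes "real_trig_poly n F" "real_trig_poly n G"
  shows "real_trig_poly n (\<lambda>z. F z + G z)"
proof -
  obtain m :: nat and q e f where
    F: "\<And>z. F z = (\<Sum>k<m. q k * (\<Prod>j = 1..n. cos (z j) ^ e k j * sin (z j) ^ f k j))"
    using assms(1) unfolding real_trig_poly_def by blast
  obtain m' :: nat and q' e' f' where
    G: "\<And>z. G z = (\<Sum>k<m'. q' k * (\<Prod>j = 1..n. cos (z j) ^ e' k j * sin (z j) ^ f' k j))"
    using assms(2) unfolding real_trig_poly_def by blast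
  show ?thesis
    by (rule real_trig_poly_finite_sum[where I = "{..<m::nat} <+> {..<m'::nat}"
          and q = "case_sum q q'" and e = "case_sum e e'" and f = "case_sum f f'"])
       (simp_all add: F G sum.Plus)
qed

lemma real_trig_poly_mult:
  assumes "real_trig_poly n F" "real_trig_poly n G"
  shows "real_trig_poly n (\<lambda>z. F z * G z)"
proof -
  obtain m :: nat and q e f where
    F: "\<And>z. F z = (\<Sum>k<m. q k * (\<Prod>j = 1..n. cos (z j) ^ e k j * sin (z j) ^ f k j))"
    using assms(1) unfolding real_trig_poly_def by blast
  obtain m' :: nat and q' e' f' where
    G: "\<And>z. G z = (\<Sum>k<m'. q' k * (\<Prod>j = 1..n. cos (z j) ^ e' k j * sin (z j) ^ f' k j))"
    using assms(2) unfolding real_trig_poly_def by blast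
  show ?thesis
  proof (rule real_trig_poly_finite_sum[where I = "{..<m} \<times> {..<m'}"
        and q = "\<lambda>(k, l). q k * q' l" and e = "\<lambda>(k, l) j. e k j + e' l j"
        and f = "\<lambda>(k, l) j. f k j + f' l j"])
    show "F z * G z = (\<Sum>p\<in>{..<m} \<times> {..<m'}. (case p of (k, l) \<Rightarrow> q k * q' l) *
        (\<Prod>j = 1..n. cos (z j) ^ (case p of (k, l) \<Rightarrow> \<lambda>j. e k j + e' l j) j *
                     sin (z j) ^ (case p of (k, l) \<Rightarrow> \<lambda>j. f k j + f' l j) j))" for z
      unfolding F G sum_product sum.cartesian_product
      by (intro sum.cong) (auto simp: power_add prod.distrib algebra_simps)
  qed simp
qed

text \<open>Complex coefficients are needed on the way, since the entries of the observable are complex.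
  Keeping both parts real polynomials makes the passage to the real part immediate.\<close>

definition complex_trig_poly :: "nat \<Rightarrow> ((nat \<Rightarrow> real) \<Rightarrow> complex) \<Rightarrow> bool" where
  "complex_trig_poly n g \<longleftrightarrow>
     real_trig_poly n (\<lambda>z. Re (g z)) \<and> real_trig_poly n (\<lambda>z. Im (g z))"

lemma complex_trig_poly_const: "complex_trig_poly n (\<lambda>z. w)"
  by (simp add: complex_trig_poly_def real_trig_poly_const)

lemma complex_trig_poly_of_real:
  "real_trig_poly n F \<Longrightarrow> complex_trig_poly n (\<lambda>z. complex_of_real (F z))"
  by (simp add: complex_trig_poly_def real_trig_poly_const)

lemma complex_trig_poly_add:
  "complex_trig_poly n g \<Longrightarrow> complex_trig_poly n h \<Longrightarrow> complex_trig_poly n (\<lambda>z. g z + h z)"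
  by (simp add: complex_trig_poly_def real_trig_poly_add)

lemma complex_trig_poly_mult:
  assumes "complex_trig_poly n g" "complex_trig_poly n h"
  shows "complex_trig_poly n (\<lambda>z. g z * h z)"
proof -
  have "real_trig_poly n (\<lambda>z. Re (g z) * Re (h z) + (- 1) * (Im (g z) * Im (h z)))"
    "real_trig_poly n (\<lambda>z. Re (g z) * Im (h z) + Im (g z) * Re (h z))"
    using assms unfolding complex_trig_poly_def
    by (intro real_trig_poly_add real_trig_poly_mult real_trig_poly_const; simp)+
  then show ?thesis
    by (simp add: complex_trig_poly_def)
qed

lemma complex_trig_poly_sum:
  "(\<And>k. k \<in> I \<Longrightarrow> complex_trig_poly n (g k)) \<Longrightarrow> complex_trig_poly n (\<lambda>z. \<Sum>k\<in>I. g k z)"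
  by (induction I rule: infinite_finite_induct)
     (simp_all add: complex_trig_poly_const complex_trig_poly_add)

lemma complex_trig_poly_prod:
  "(\<And>k. k \<in> I \<Longrightarrow> complex_trig_poly n (g k)) \<Longrightarrow> complex_trig_poly n (\<lambda>z. \<Prod>k\<in>I. g k z)"
  by (induction I rule: infinite_finite_induct)
     (simp_all add: complex_trig_poly_const complex_trig_poly_mult)

section \<open>Adjoints of complex matrices\<close>

lemma dim_mat_adjoint [simp]:
  "dim_row (mat_adjoint A) = dim_col A" "dim_col (mat_adjoint A) = dim_row A"
  by (simp_all add: mat_adjoint_def)

lemma mat_adjoint_carrier: "A \<in> carrier_mat m k \<Longrightarrow> mat_adjoint A \<in> carrier_mat k m"
  by auto

lemma mat_adjoint_entry:
  fixes A :: "complex mat"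
  assumes "i < dim_col A" "j < dim_row A"
  shows "mat_adjoint A $$ (i, j) = cnj (A $$ (j, i))"
  unfolding mat_adjoint_def mat_of_rows_def using assms by simp

lemma mat_adjoint_adjoint:
  fixes A :: "complex mat"
  shows "mat_adjoint (mat_adjoint A) = A"
  by (rule eq_matI) (simp_all add: mat_adjoint_entry)

lemma mat_adjoint_mult:
  fixes A B :: "complex mat"
  assumes "A \<in> carrier_mat m k" "B \<in> carrier_mat k l"
  shows "mat_adjoint (A * B) = mat_adjoint B * mat_adjoint A"
  by (rule eq_matI)
     (use assms in \<open>auto simp: mat_adjoint_entry scalar_prod_def mult.commute intro!: sum.cong\<close>)

lemma sandwich_carrier:
  assumes "M \<in> carrier_mat m m" "A \<in> carrier_mat m k"
  shows "mat_adjoint A * M * A \<in> carrier_mat k k"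
  by (rule mult_carrier_mat[OF mult_carrier_mat[OF mat_adjoint_carrier[OF assms(2)] assms(1)] assms(2)])

text \<open>Both the evolution of an observable by a circuit and its expectation in a state, read as a
  \<open>1 \<times> 1\<close> matrix, have the form \<open>A\<^sup>* M A\<close>.\<close>

lemma mat_adjoint_sandwich:
  fixes M A :: "complex mat"
  assumes M: "M \<in> carrier_mat m m" and A: "A \<in> carrier_mat m k" and herm: "mat_adjoint M = M"
  shows "mat_adjoint (mat_adjoint A * M * A) = mat_adjoint A * M * A"
proof -
  note A' = mat_adjoint_carrier[OF A]
  have "mat_adjoint (mat_adjoint A * M * A) = mat_adjoint A * (mat_adjoint M * mat_adjoint (mat_adjoint A))"
    by (simp add: mat_adjoint_mult[OF mult_carrier_mat[OF A' M] A] mat_adjoint_mult[OF A' M])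
  also have "\<dots> = mat_adjoint A * M * A"
    by (simp add: herm mat_adjoint_adjoint assoc_mult_mat[OF A' M A])
  finally show ?thesis .
qed

text \<open>The two entries of \<open>A\<close> are kept together as one factor because, for the feature map, it is
  only their product that is a trigonometric polynomial.\<close>

lemma sandwich_entry:
  fixes A M :: "complex mat"
  assumes "A \<in> carrier_mat m k" "M \<in> carrier_mat m m" "p < k" "q < k"
  shows "(mat_adjoint A * M * A) $$ (p, q) =
    (\<Sum>s<m. \<Sum>r<m. M $$ (r, s) * (cnj (A $$ (r, p)) * A $$ (s, q)))"
proof -
  have "(mat_adjoint A * M * A) $$ (p, q) =
      (\<Sum>s<m. (\<Sum>r<m. cnj (A $$ (r, p)) * M $$ (r, s)) * A $$ (s, q))"
    using assms by (simp add: scalar_prod_def mat_adjoint_entry lessThan_atLeast0)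
  then show ?thesis
    by (simp only: sum_distrib_right mult.assoc mult.left_commute)
qed

section \<open>Entries of tensor products\<close>

lemma kron_carrier:
  "A \<in> carrier_mat r c \<Longrightarrow> B \<in> carrier_mat r' c' \<Longrightarrow> kron A B \<in> carrier_mat (r * r') (c * c')"
  by (auto simp: kron_def)

lemma foldr_kron_carrier:
  assumes "\<And>x. x \<in> set xs \<Longrightarrow> A x \<in> carrier_mat r c"
  shows "foldr kron (map A xs) (1\<^sub>m 1) \<in> carrier_mat (r ^ length xs) (c ^ length xs)"
  using assms by (induction xs) (simp_all add: kron_carrier)

lemma tensor_carrier:
  assumes "\<And>j. A j \<in> carrier_mat r c"
  shows "tensor n A \<in> carrier_mat (r ^ n) (c ^ n)"
  using foldr_kron_carrier[of "[1..<Suc n]" A r c] assms by (simp add: tensor_def del: upt_Suc)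

text \<open>The low-order base-\<open>m\<close> digits of \<open>p\<close> survive reduction modulo a larger power of \<open>m\<close>. This makes
  the indices that the Kronecker product passes to its right factor have the same digits as the
  original ones.\<close>

lemma div_mod_power_less_digit:
  fixes p m :: nat
  assumes "k < l"
  shows "p mod m ^ l div m ^ k mod m = p div m ^ k mod m"
proof -
  have l: "m ^ l = m ^ k * m ^ (l - k)" and d: "m dvd m ^ (l - k)"
    using assms by (simp_all add: power_add[symmetric])
  show ?thesis
  proof (cases "m = 0")
    case False
    then have "p mod m ^ l div m ^ k = p div m ^ k mod m ^ (l - k)"
      unfolding l mod_mult2_eq by simp
    then show ?thesis
      by (simp add: mod_mod_cancel[OF d])
  qed (use assms in \<open>simp add: power_0_left\<close>)
qed

text \<open>The leftmost factor reads the most significant base-\<open>m\<close> digits of the row and column index,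
  and each further factor the next ones.\<close>

lemma foldr_kron_entry:
  assumes "\<And>x. x \<in> set xs \<Longrightarrow> A x \<in> carrier_mat m m" "p < m ^ length xs" "q < m ^ length xs"
  shows "foldr kron (map A xs) (1\<^sub>m 1) $$ (p, q) =
    (\<Prod>i<length xs. A (xs ! i) $$
       (p div m ^ (length xs - Suc i) mod m, q div m ^ (length xs - Suc i) mod m))"
  using assms
proof (induction xs arbitrary: p q)
  case (Cons x xs)
  let ?l = "length xs" and ?B = "foldr kron (map A xs) (1\<^sub>m 1)"
  have m: "0 < m" using Cons.prems(2) by (cases "m = 0") auto
  have Ax: "A x \<in> carrier_mat m m" and B: "?B \<in> carrier_mat (m ^ ?l) (m ^ ?l)"
    using Cons.prems(1) foldr_kron_carrier[of xs A m m] by auto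
  have lt: "p div m ^ ?l < m" "q div m ^ ?l < m"
    using Cons.prems(2,3) by (simp_all add: less_mult_imp_div_less)
  have "foldr kron (map A (x # xs)) (1\<^sub>m 1) $$ (p, q) =
      A x $$ (p div m ^ ?l, q div m ^ ?l) * ?B $$ (p mod m ^ ?l, q mod m ^ ?l)"
    using Cons.prems(2,3) Ax B by (simp add: kron_def)
  also have "?B $$ (p mod m ^ ?l, q mod m ^ ?l) = (\<Prod>i<?l. A (xs ! i) $$
      (p mod m ^ ?l div m ^ (?l - Suc i) mod m, q mod m ^ ?l div m ^ (?l - Suc i) mod m))"
    using m Cons.prems(1) by (intro Cons.IH) auto
  also have "\<dots> = (\<Prod>i<?l. A (xs ! i) $$
      (p div m ^ (?l - Suc i) mod m, q div m ^ (?l - Suc i) mod m))"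
    by (intro prod.cong refl) (simp add: div_mod_power_less_digit)
  finally show ?case
    using lt by (simp add: prod.lessThan_Suc_shift del: prod.lessThan_Suc)
qed simp

lemma tensor_entry:
  assumes "\<And>j. A j \<in> carrier_mat m m" "p < m ^ n" "q < m ^ n"
  shows "tensor n A $$ (p, q) =
    (\<Prod>i<n. A (Suc i) $$ (p div m ^ (n - Suc i) mod m, q div m ^ (n - Suc i) mod m))"
  using foldr_kron_entry[of "[1..<Suc n]" A m p q] assms
  by (simp add: tensor_def del: upt_Suc)

text \<open>Transposing swaps the two index digits seen by each factor simultaneously, so the product
  formula reduces the claim to the individual factors.\<close>

lemma tensor_hermitian:
  assumes A: "\<And>j. A j \<in> carrier_mat m m" and herm: "\<And>j. mat_adjoint (A j) = A j"
  shows "mat_adjoint (tensor n A) = tensor n A"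
proof (rule eq_matI)
  note dims = carrier_matD[OF tensor_carrier[of A m m n, OF A]]
  fix p q assume "p < dim_row (tensor n A)" "q < dim_col (tensor n A)"
  then have p: "p < m ^ n" and q: "q < m ^ n"
    using dims by auto
  have flip: "cnj (A j $$ (s mod m, r mod m)) = A j $$ (r mod m, s mod m)" if "0 < m" for j r s
    using mat_adjoint_entry[of "r mod m" "A j" "s mod m"] carrier_matD[OF A[of j]] herm[of j] that
    by simp
  \<comment> \<open>For \<open>m = 0\<close> the digits modulo \<open>m\<close> would be out of range, but then the matrix is empty unless
    there are no factors at all.\<close>
  have "n = 0 \<or> 0 < m"
    using p by (cases "m = 0") (auto simp: power_0_left split: if_splits)
  then show "mat_adjoint (tensor n A) $$ (p, q) = tensor n A $$ (p, q)"
    using p q by (auto simp: mat_adjoint_entry dims tensor_entry[OF A] flip)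
qed (simp_all add: carrier_matD[OF tensor_carrier[of A m m n, OF A]])

section \<open>Gates and observables of the circuit\<close>

lemma gate_carrier:
  "Ry z \<in> carrier_mat 2 2" "Rz z \<in> carrier_mat 2 2" "pauli_X \<in> carrier_mat 2 2"
  "pauli_Z \<in> carrier_mat 2 2" "proj0 \<in> carrier_mat 2 2" "proj1 \<in> carrier_mat 2 2"
  by (auto simp: Ry_def Rz_def pauli_X_def pauli_Z_def proj0_def proj1_def mat_of_rows_list_def
      intro!: carrier_matI)

lemma rotation_gate_carrier: "rotation_gate t \<in> carrier_mat 2 2"
  by (cases t) (auto simp: rotation_gate_def intro!: mult_carrier_mat gate_carrier)

lemma mat_prod_carrier:
  assumes "\<And>l. A l \<in> carrier_mat N N"
  shows "mat_prod N m A \<in> carrier_mat N N"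
proof -
  have "foldr (*) (map A xs) (1\<^sub>m N) \<in> carrier_mat N N" for xs
    by (induction xs) (auto intro!: mult_carrier_mat assms)
  then show ?thesis by (simp add: mat_prod_def del: upt_Suc)
qed

lemma CNOT_carrier: "CNOT n j k \<in> carrier_mat (2 ^ n) (2 ^ n)"
  unfolding CNOT_def by (intro add_carrier_mat tensor_carrier) (auto simp: gate_carrier)

lemma entangler_carrier: "entangler n \<in> carrier_mat (2 ^ n) (2 ^ n)"
  unfolding entangler_def by (auto intro!: mult_carrier_mat mat_prod_carrier CNOT_carrier)

lemma U_Theta_carrier: "U_Theta n L \<Gamma> \<in> carrier_mat (2 ^ n) (2 ^ n)"
  unfolding U_Theta_def var_layer_def
  by (intro mat_prod_carrier mult_carrier_mat[OF entangler_carrier] tensor_carrier rotation_gate_carrier)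

lemma Z_at_carrier: "Z_at n i \<in> carrier_mat (2 ^ n) (2 ^ n)"
  unfolding Z_at_def by (rule tensor_carrier) (simp add: gate_carrier)

lemma ket0_carrier: "ket0 n \<in> carrier_mat (2 ^ n) 1"
proof -
  have "mat_of_rows_list 1 [[1], [0]] \<in> carrier_mat 2 1"
    by (auto simp: mat_of_rows_list_def intro!: carrier_matI)
  then show ?thesis
    using tensor_carrier[of "\<lambda>_. mat_of_rows_list 1 [[1], [0]]" 2 1 n] by (simp add: ket0_def)
qed

lemma pauli_Z_hermitian: "mat_adjoint pauli_Z = pauli_Z"
  by (rule eq_matI)
     (auto simp: mat_adjoint_entry pauli_Z_def mat_of_rows_list_def less_Suc_eq numeral_2_eq_2)

lemma one_mat_hermitian: "mat_adjoint (1\<^sub>m m :: complex mat) = 1\<^sub>m m"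
  by (rule eq_matI) (auto simp: mat_adjoint_entry)

lemma Z_at_hermitian: "mat_adjoint (Z_at n i) = Z_at n i"
  unfolding Z_at_def
  by (rule tensor_hermitian[where m = 2]) (simp_all add: gate_carrier pauli_Z_hermitian one_mat_hermitian)

section \<open>Expectations as trigonometric polynomials\<close>

text \<open>The step where half angles disappear: every entry of \<open>Ry t\<close> is \<open>\<plusminus> cos (t / 2)\<close> or
  \<open>\<plusminus> sin (t / 2)\<close>, and a product of two such functions is an affine function of \<open>cos t\<close> or a
  multiple of \<open>sin t\<close>.\<close>

lemma Ry_entry_product_trig_poly:
  assumes "j \<in> {1..n}" "r < 2" "s < 2" "r' < 2" "s' < 2"
  shows "complex_trig_poly n (\<lambda>z. cnj (Ry (z j) $$ (r, s)) * Ry (z j) $$ (r', s'))"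
proof -
  have half: "cos (t / 2) * cos (t / 2) = 1 / 2 + 1 / 2 * cos t"
    "sin (t / 2) * sin (t / 2) = 1 / 2 + (- 1 / 2) * cos t"
    "cos (t / 2) * sin (t / 2) = 1 / 2 * sin t"
    "sin (t / 2) * cos (t / 2) = 1 / 2 * sin t" for t :: real
    using cos_double_cos[of "t / 2"] cos_double_sin[of "t / 2"] sin_double[of "t / 2"]
    by (simp_all add: power2_eq_square field_simps)
  have affine: "real_trig_poly n (\<lambda>z. u + v * cos (z j))" "real_trig_poly n (\<lambda>z. v * sin (z j))" for u v
    by (intro real_trig_poly_add real_trig_poly_mult real_trig_poly_const real_trig_poly_cos
        real_trig_poly_sin assms(1))+
  have half_products: "real_trig_poly n (\<lambda>z. cos (z j / 2) * cos (z j / 2))"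
    "real_trig_poly n (\<lambda>z. sin (z j / 2) * sin (z j / 2))"
    "real_trig_poly n (\<lambda>z. cos (z j / 2) * sin (z j / 2))"
    "real_trig_poly n (\<lambda>z. sin (z j / 2) * cos (z j / 2))"
    unfolding half by (rule affine)+
  let ?H = "{\<lambda>t. cos (t / 2), \<lambda>t. sin (t / 2)} :: (real \<Rightarrow> real) set"
  have prod: "real_trig_poly n (\<lambda>z. x (z j) * y (z j))" if "x \<in> ?H" "y \<in> ?H" for x y
    using that half_products by auto
  have entry: "\<exists>w. \<exists>x\<in>?H. \<forall>t. Ry t $$ (k, l) = complex_of_real (w * x t)" if "k < 2" "l < 2" for k l
  proof (cases "k = l")
    case True
    have "Ry t $$ (k, l) = complex_of_real (1 * cos (t / 2))" for t
      using that True by (auto simp: Ry_def mat_of_rows_list_def less_2_cases_iff)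
    then show ?thesis by (intro exI[of _ 1] bexI[of _ "\<lambda>t. cos (t / 2)"]) auto
  next
    case False
    have "Ry t $$ (k, l) = complex_of_real ((if k = 0 then - 1 else 1) * sin (t / 2))" for t
      using that False by (auto simp: Ry_def mat_of_rows_list_def less_2_cases_iff)
    then show ?thesis
      by (intro exI[of _ "if k = 0 then - 1 else 1"] bexI[of _ "\<lambda>t. sin (t / 2)"]) auto
  qed
  obtain w x w' x' where x: "x \<in> ?H" "\<And>t. Ry t $$ (r, s) = complex_of_real (w * x t)"
    and x': "x' \<in> ?H" "\<And>t. Ry t $$ (r', s') = complex_of_real (w' * x' t)"
    using entry[of r s] entry[of r' s'] assms(2-5) by blast
  have "cnj (Ry t $$ (r, s)) * Ry t $$ (r', s') = complex_of_real (w * w' * (x t * x' t))" for t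
    by (simp add: x(2) x'(2))
  moreover have "complex_trig_poly n (\<lambda>z. complex_of_real (w * w' * (x (z j) * x' (z j))))"
    by (intro complex_trig_poly_of_real real_trig_poly_mult real_trig_poly_const prod x(1) x'(1))
  ultimately show ?thesis
    by simp
qed

lemma feature_entry_product_trig_poly:
  assumes "p < 2 ^ n" "q < 2 ^ n" "p' < 2 ^ n" "q' < 2 ^ n"
  shows "complex_trig_poly n (\<lambda>z. cnj (tensor n (\<lambda>j. Ry (z j)) $$ (p, q)) * tensor n (\<lambda>j. Ry (z j)) $$ (p', q'))"
proof -
  let ?d = "\<lambda>i k :: nat. k div 2 ^ (n - Suc i) mod 2"
  have entry: "tensor n (\<lambda>j. Ry (z j)) $$ (k, l) = (\<Prod>i<n. Ry (z (Suc i)) $$ (?d i k, ?d i l))"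
    if "k < 2 ^ n" "l < 2 ^ n" for z k l
    by (rule tensor_entry[OF gate_carrier(1) that])
  have "complex_trig_poly n (\<lambda>z. \<Prod>i<n.
      cnj (Ry (z (Suc i)) $$ (?d i p, ?d i q)) * Ry (z (Suc i)) $$ (?d i p', ?d i q'))"
    by (intro complex_trig_poly_prod Ry_entry_product_trig_poly) auto
  then show ?thesis
    by (simp only: entry assms cnj_prod prod.distrib)
qed

text \<open>The expectation of an arbitrary observable \<open>M\<close> in the encoded state, as a function of the
  rotation angles. The variational layers are absorbed into \<open>M\<close>.\<close>

definition circuit_expect :: "nat \<Rightarrow> complex mat \<Rightarrow> (nat \<Rightarrow> real) \<Rightarrow> complex" where
  "circuit_expect n M z =
     (let V = tensor n (\<lambda>j. Ry (z j))
      in (mat_adjoint (ket0 n) * (mat_adjoint V * M * V) * ket0 n) $$ (0, 0))"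

text \<open>Expanding both conjugations, by the input state and by the feature map, leaves constants times
  products of two feature map entries.\<close>

lemma circuit_expect_trig_poly:
  assumes "M \<in> carrier_mat (2 ^ n) (2 ^ n)"
  shows "complex_trig_poly n (circuit_expect n M)"
proof -
  define V where "V z = tensor n (\<lambda>j. Ry (z j))" for z :: "nat \<Rightarrow> real"
  have V: "V z \<in> carrier_mat (2 ^ n) (2 ^ n)" for z
    unfolding V_def by (rule tensor_carrier) (rule gate_carrier)
  have X: "mat_adjoint (V z) * M * V z \<in> carrier_mat (2 ^ n) (2 ^ n)" for z
    by (rule sandwich_carrier[OF assms V])
  have "circuit_expect n M z = (\<Sum>s<2^n. \<Sum>r<2^n. (mat_adjoint (V z) * M * V z) $$ (r, s) *
      (cnj (ket0 n $$ (r, 0)) * ket0 n $$ (s, 0)))" for z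
    unfolding circuit_expect_def Let_def V_def[symmetric]
    by (rule sandwich_entry[OF ket0_carrier X]) simp_all
  also have "\<dots> z = (\<Sum>s<2^n. \<Sum>r<2^n.
      (\<Sum>s'<2^n. \<Sum>r'<2^n. M $$ (r', s') * (cnj (V z $$ (r', r)) * V z $$ (s', s))) *
      (cnj (ket0 n $$ (r, 0)) * ket0 n $$ (s, 0)))" for z
    by (intro sum.cong refl arg_cong2[where f = "(*)"] sandwich_entry[OF V assms]) simp_all
  finally have eq: "circuit_expect n M = (\<lambda>z. \<Sum>s<2^n. \<Sum>r<2^n.
      (\<Sum>s'<2^n. \<Sum>r'<2^n. M $$ (r', s') * (cnj (V z $$ (r', r)) * V z $$ (s', s))) *
      (cnj (ket0 n $$ (r, 0)) * ket0 n $$ (s, 0)))"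
    by (rule ext)
  show ?thesis
    unfolding eq V_def
    by (intro complex_trig_poly_sum complex_trig_poly_mult complex_trig_poly_const
        feature_entry_product_trig_poly) simp_all
qed

text \<open>The expectation is a diagonal entry of a Hermitian matrix.\<close>

lemma circuit_expect_real:
  assumes M: "M \<in> carrier_mat (2 ^ n) (2 ^ n)" "mat_adjoint M = M"
  shows "complex_of_real (Re (circuit_expect n M z)) = circuit_expect n M z"
proof -
  define V where "V = tensor n (\<lambda>j. Ry (z j))"
  let ?H = "mat_adjoint (ket0 n) * (mat_adjoint V * M * V) * ket0 n"
  have V: "V \<in> carrier_mat (2 ^ n) (2 ^ n)"
    unfolding V_def by (rule tensor_carrier) (rule gate_carrier)
  have "mat_adjoint ?H = ?H"
    by (rule mat_adjoint_sandwich[OF sandwich_carrier[OF M(1) V] ket0_carrier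
          mat_adjoint_sandwich[OF M(1) V M(2)]])
  then have "cnj (?H $$ (0, 0)) = ?H $$ (0, 0)"
    using mat_adjoint_entry[of 0 ?H 0] carrier_matD[OF ket0_carrier[of n]] by simp
  then show ?thesis
    by (simp add: circuit_expect_def Let_def V_def complex_eq_iff)
qed

text \<open>The Heisenberg-evolved observable: the only place where \<open>\<Gamma>\<close> enters.\<close>

definition evolved_Z :: "nat \<Rightarrow> nat \<Rightarrow> var_params \<Rightarrow> nat \<Rightarrow> complex mat" where
  "evolved_Z n L \<Gamma> i = mat_adjoint (U_Theta n L \<Gamma>) * Z_at n i * U_Theta n L \<Gamma>"

lemma evolved_Z_carrier: "evolved_Z n L \<Gamma> i \<in> carrier_mat (2 ^ n) (2 ^ n)"
  unfolding evolved_Z_def by (rule sandwich_carrier[OF Z_at_carrier U_Theta_carrier])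

lemma evolved_Z_hermitian: "mat_adjoint (evolved_Z n L \<Gamma> i) = evolved_Z n L \<Gamma> i"
  unfolding evolved_Z_def by (rule mat_adjoint_sandwich[OF Z_at_carrier U_Theta_carrier Z_at_hermitian])

lemma q_expect_eq_circuit_expect:
  "q_expect n L a b \<Gamma> i x = circuit_expect n (evolved_Z n L \<Gamma> i) (feature_arg a b x)"
proof -
  define U V Z where "U = U_Theta n L \<Gamma>" and "V = U_psi n a b x" and "Z = Z_at n i"
  have c: "U \<in> carrier_mat (2 ^ n) (2 ^ n)" "V \<in> carrier_mat (2 ^ n) (2 ^ n)"
    "Z \<in> carrier_mat (2 ^ n) (2 ^ n)"
    by (simp_all add: U_def V_def Z_def U_Theta_carrier Z_at_carrier U_psi_def tensor_carrier gate_carrier)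
  note c' = c mat_adjoint_carrier[OF c(1)] mat_adjoint_carrier[OF c(2)]
  have "mat_adjoint (U * V) * Z * (U * V) = mat_adjoint V * (mat_adjoint U * Z * U) * V"
    using c' by (simp add: mat_adjoint_mult[OF c(1,2)] assoc_mult_mat[of _ "2^n" "2^n" _ "2^n" _ "2^n"])
  then show ?thesis
    by (simp add: q_expect_def circuit_expect_def evolved_Z_def Let_def U_def V_def Z_def U_psi_def)
qed

theorem proposition4p1:
  fixes n L :: nat
  shows "\<exists>F :: nat \<Rightarrow> var_params \<Rightarrow> (nat \<Rightarrow> real) \<Rightarrow> real.
    (\<forall>\<Gamma>. \<forall>i\<in>{1..n}. real_trig_poly n (F i \<Gamma>)) \<and>
    (\<forall>(d :: nat) (a :: nat \<Rightarrow> real vec) (b :: nat \<Rightarrow> real) (\<Gamma> :: var_params)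
       (c :: nat \<Rightarrow> real) (c0 :: real) (x :: real vec).
       (\<forall>i\<in>{1..n}. a i \<in> carrier_vec d) \<longrightarrow> x \<in> carrier_vec d \<longrightarrow>
       qnn_output n L a b \<Gamma> c c0 x =
         complex_of_real ((\<Sum>i = 1..n. c i * F i \<Gamma> (\<lambda>j. scalar_prod (a j) x + b j)) + c0))"
proof (intro exI[of _ "\<lambda>i \<Gamma> z. Re (circuit_expect n (evolved_Z n L \<Gamma> i) z)"] conjI allI ballI impI)
  show "real_trig_poly n (\<lambda>z. Re (circuit_expect n (evolved_Z n L \<Gamma> i) z))" for \<Gamma> i
    using circuit_expect_trig_poly[OF evolved_Z_carrier] by (simp add: complex_trig_poly_def)
next
  fix d :: nat and a :: "nat \<Rightarrow> real vec" and b :: "nat \<Rightarrow> real" and \<Gamma> :: var_params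
    and c :: "nat \<Rightarrow> real" and c0 :: real and x :: "real vec"
  have "q_expect n L a b \<Gamma> i x = complex_of_real
      (Re (circuit_expect n (evolved_Z n L \<Gamma> i) (\<lambda>j. scalar_prod (a j) x + b j)))" for i
    by (simp add: q_expect_eq_circuit_expect feature_arg_def[abs_def]
        circuit_expect_real[OF evolved_Z_carrier evolved_Z_hermitian])
  then show "qnn_output n L a b \<Gamma> c c0 x = complex_of_real
      ((\<Sum>i = 1..n. c i * Re (circuit_expect n (evolved_Z n L \<Gamma> i) (\<lambda>j. scalar_prod (a j) x + b j))) + c0)"
    by (simp add: qnn_output_def)
qed

end
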